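(* Consider the Volterra integro-differential equation $$y'(x) = f(x,y(x)) + \int_{x_0}^x K(x,t,y(t))\,dt,\qquad y(x_0)=y_0,$$ where $f$ and $K$ are continuous and satisfy $|f(x,u)-f(x,v)|\le L_1|u-v|$ and $|K(x,t,u)-K(x,t,v)|\le L_2|u-v|$ for some constants $L_1,L_2$, all $x,t$ with $|x-x_0|\le a$, $|t-x_0|\le a$, and all $u,v$. Let $h>0$ be the step size, $x_j=x_0+jh$, and let $y_1,y_2,\dots,y_N$ be generated by the numerical method $$y_{j+1}=M_1+\frac{h}{2}f(x_{j+1},M_2)+\frac{h^2}{4}K(x_{j+1},x_{j+1},M_2),$$ where $$M_1=y_j+\frac{h}{2}f(x_j,y_j)+\frac{h^2}{4}\bigl(K(x_j,x_0,y_0)+K(x_j,x_j,y_j)+K(x_{j+1},x_0,y_0)\bigr)+\frac{h^2}{2}\Bigl(\sum_{i=1}^{j-1}K(x_j,x_i,y_i)+\sum_{i=1}^{j}K(x_{j+1},x_i,y_i)\Bigr),$$ $$M_2=M_1+\frac{h}{2}f(x_{j+1},M_1)+\frac{h^2}{4}K(x_{j+1},x_{j+1},M_1).$$ Then this numerical method is convergent.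
   Context: $y(x_j)$ denotes the exact solution at the grid point $x_j$, and $y_j$ its approximation obtained by the method with step size $h$; the grid points lie in $[x_0,x_0+a]$. A method is said to be convergent if and only if $|y(x_j)-y_j|\to 0$ as $h\to 0$, for $j=1,2,\dots,N$. The terms with $K(x_j,\cdot,\cdot)$ in $M_1$ come from the composite trapezium approximation of $\int_{x_0}^{x_j}K(x_j,t,y(t))\,dt$; for $j=0$ this integral is zero, these terms are absent, and $M_1=y_0+\frac{h}{2}f(x_0,y_0)+\frac{h^2}{4}K(x_1,x_0,y_0)$. *)

theory Defs
  imports "HOL-Analysis.Analysis"
begin

(* The derivative is one-sided at the two end points of the interval. *)
definition vide_solution ::
  "(real \<Rightarrow> real \<Rightarrow> real) \<Rightarrow> (real \<Rightarrow> real \<Rightarrow> real \<Rightarrow> real) \<Rightarrow> real \<Rightarrow> real \<Rightarrow> real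
    \<Rightarrow> (real \<Rightarrow> real) \<Rightarrow> bool" where
  "vide_solution f K x0 y0 a y \<longleftrightarrow>
     y x0 = y0 \<and>
     (\<forall>x\<in>{x0..x0 + a}.
        (y has_real_derivative f x (y x) + integral {x0..x} (\<lambda>t. K x t (y t)))
          (at x within {x0..x0 + a}))"

definition grid :: "real \<Rightarrow> real \<Rightarrow> nat \<Rightarrow> real" where
  "grid x0 h j = x0 + real j * h"

(* In the following definitions Y is the sequence of approximations, with Y 0 the initial
   value.  The terms K(x_j, _, _) are the composite trapezium rule on [x_0, x_j], which is
   empty for j = 0; hence the case distinction (the first sum is empty for j = 0 anyway). *)
definition M1 ::
  "(real \<Rightarrow> real \<Rightarrow> real) \<Rightarrow> (real \<Rightarrow> real \<Rightarrow> real \<Rightarrow> real) \<Rightarrow> real \<Rightarrow> real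
    \<Rightarrow> (nat \<Rightarrow> real) \<Rightarrow> nat \<Rightarrow> real" where
  "M1 f K x0 h Y j =
     (let x = grid x0 h in
      Y j + h / 2 * f (x j) (Y j)
      + h\<^sup>2 / 4 * ((if j = 0 then 0 else K (x j) x0 (Y 0) + K (x j) (x j) (Y j))
                  + K (x (j + 1)) x0 (Y 0))
      + h\<^sup>2 / 2 * ((\<Sum>i=1..<j. K (x j) (x i) (Y i))
                  + (\<Sum>i=1..j. K (x (j + 1)) (x i) (Y i))))"

definition M2 ::
  "(real \<Rightarrow> real \<Rightarrow> real) \<Rightarrow> (real \<Rightarrow> real \<Rightarrow> real \<Rightarrow> real) \<Rightarrow> real \<Rightarrow> real
    \<Rightarrow> (nat \<Rightarrow> real) \<Rightarrow> nat \<Rightarrow> real" where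
  "M2 f K x0 h Y j =
     (let x = grid x0 h; m = M1 f K x0 h Y j in
      m + h / 2 * f (x (j + 1)) m + h\<^sup>2 / 4 * K (x (j + 1)) (x (j + 1)) m)"

definition generated_by_method ::
  "(real \<Rightarrow> real \<Rightarrow> real) \<Rightarrow> (real \<Rightarrow> real \<Rightarrow> real \<Rightarrow> real) \<Rightarrow> real \<Rightarrow> real \<Rightarrow> real \<Rightarrow> nat
    \<Rightarrow> (nat \<Rightarrow> real) \<Rightarrow> bool" where
  "generated_by_method f K x0 y0 h N Y \<longleftrightarrow>
     Y 0 = y0 \<and>
     (\<forall>j<N. let x = grid x0 h; m = M2 f K x0 h Y j in
        Y (j + 1) = M1 f K x0 h Y j + h / 2 * f (x (j + 1)) m
                    + h\<^sup>2 / 4 * K (x (j + 1)) (x (j + 1)) m)"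

(* Y h j is the approximation at the j-th grid point for step size h.  The number N of steps
   may grow as h tends to 0, subject only to the grid staying inside [x0, x0 + a]; the
   convergence is uniform over all these grid points. *)
definition method_convergent ::
  "real \<Rightarrow> real \<Rightarrow> (real \<Rightarrow> real) \<Rightarrow> (real \<Rightarrow> nat \<Rightarrow> real) \<Rightarrow> bool" where
  "method_convergent x0 a y Y \<longleftrightarrow>
     (\<forall>e>0. \<forall>\<^sub>F h in at_right 0.
        \<forall>N. grid x0 h N \<le> x0 + a \<longrightarrow> (\<forall>j\<in>{1..N}. \<bar>y (grid x0 h j) - Y h j\<bar> < e))"

end

theory Submission
  imports Defs
begin

text \<open>
  The scheme is two sweeps of a fixed-point iteration for the implicit trapezium rule. Write
  \<open>G\<close> for the right-hand side of the equation with its integral replaced by the composite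
  trapezium sum over the grid, and let \<open>corrector\<close> send a guess \<open>m\<close> for the next value to
  \<open>v j + h / 2 * (G j + G (j + 1))\<close>, where \<open>m\<close> is the value used at the new grid point. The
  quantity \<open>M1\<close> is this expression without the two terms that involve \<open>m\<close>, so that
  \<open>M2 = corrector M1\<close> and the next approximation is \<open>corrector M2\<close>
  (\<open>M1_plus_implicit_terms\<close> and its consequences).

  Consistency. The data are only continuous, so no rate of convergence is available, but the
  slope \<open>y'\<close> is uniformly continuous on the interval and so is \<open>K x t (y t)\<close> on the square.
  By the mean value theorem an exact increment is \<open>h\<close> times \<open>y'\<close> at an intermediate point,
  and uniform continuity makes that slope close to \<open>G\<close> at both neighbouring grid points. Hence
  the exact solution satisfies the implicit trapezium rule up to \<open>h * \<epsilon>\<close>, for every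
  \<open>\<epsilon> > 0\<close> once \<open>h\<close> is small (\<open>corrector_consistent\<close>).

  Stability. \<open>G\<close> is Lipschitz in the grid values with the constant \<open>L1 + a * L2\<close>, because the
  trapezium weights sum to at most the length \<open>a\<close>. So \<open>corrector\<close> moves an error of \<open>m\<close> into
  the result with a factor \<open>h * L\<close> (\<open>corrector_error\<close>). The crude guess \<open>M1\<close> is off
  by \<open>O(h)\<close> beyond the accumulated error; because of this damping it contributes only \<open>O(h^2)\<close> to
  the error of the next approximation, which is negligible against one step (\<open>one_step_error\<close>).

  A discrete Gronwall argument (\<open>geometric_error_growth\<close>) then bounds the error at all grid
  points by a constant times \<open>\<epsilon>\<close>. The equation has memory, so the quantity propagated from step
  to step is a bound for all errors so far and not only for the last one.
\<close>

section \<open>The composite trapezium rule\<close>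

text \<open>The sum is taken over panels, not over weighted nodes: it is then empty for \<open>n = 0\<close>, and
  estimates can be made panel by panel without treating the end points separately.\<close>
definition trapezium :: "real \<Rightarrow> nat \<Rightarrow> (nat \<Rightarrow> real) \<Rightarrow> real" where
  "trapezium h n u = h / 2 * (\<Sum>i<n. u i + u (Suc i))"

lemma trapezium_endpoint_form:
  "trapezium h n u = (if n = 0 then 0 else h / 2 * (u 0 + u n) + h * (\<Sum>i=1..<n. u i))"
proof -
  have "(\<Sum>i<n. u i + u (Suc i)) = (if n = 0 then 0 else u 0 + u n + 2 * (\<Sum>i=1..<n. u i))"
  proof (induction n)
    case (Suc n)
    then show ?case by (cases n) (auto simp: algebra_simps)
  qed simp
  then show ?thesis by (simp add: trapezium_def field_simps)
qed

lemma trapezium_diff_le: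
  assumes "0 \<le> h" and "\<And>i. i \<le> n \<Longrightarrow> \<bar>u i - v i\<bar> \<le> d"
  shows "\<bar>trapezium h n u - trapezium h n v\<bar> \<le> real n * h * d"
proof -
  have "\<bar>\<Sum>i<n. (u i - v i) + (u (Suc i) - v (Suc i))\<bar> \<le> (\<Sum>i<n. 2 * d)"
  proof (rule order_trans[OF sum_abs], rule sum_mono)
    fix i assume "i \<in> {..<n}"
    then show "\<bar>(u i - v i) + (u (Suc i) - v (Suc i))\<bar> \<le> 2 * d"
      using assms(2)[of i] assms(2)[of "Suc i"] by auto
  qed
  then have "h / 2 * \<bar>\<Sum>i<n. (u i - v i) + (u (Suc i) - v (Suc i))\<bar> \<le> h / 2 * (\<Sum>i<n. 2 * d)"
    using assms(1) by (intro mult_left_mono) auto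
  moreover have *: "trapezium h n u - trapezium h n v
      = h / 2 * (\<Sum>i<n. (u i - v i) + (u (Suc i) - v (Suc i)))"
    unfolding trapezium_def right_diff_distrib[symmetric] sum_subtractf[symmetric]
    by (simp add: algebra_simps)
  ultimately show ?thesis
    using assms(1) unfolding * by (simp add: abs_mult ac_simps)
qed

lemma grid_0 [simp]: "grid x0 h 0 = x0"
  by (simp add: grid_def)

lemma grid_Suc: "grid x0 h (Suc j) = grid x0 h j + h"
  by (simp add: grid_def algebra_simps)

lemma grid_mono: "0 \<le> h \<Longrightarrow> i \<le> j \<Longrightarrow> grid x0 h i \<le> grid x0 h j"
  by (simp add: grid_def mult_right_mono)

text \<open>On one panel the integrand differs from the mean of its end-point values by at most its
  oscillation \<open>w\<close>, and the panel has length \<open>h\<close>.\<close>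
lemma trapezium_integral_error:
  assumes "0 \<le> h" and "continuous_on {x0..grid x0 h n} g"
    and "\<And>s t. s \<in> {x0..grid x0 h n} \<Longrightarrow> t \<in> {x0..grid x0 h n} \<Longrightarrow> \<bar>s - t\<bar> \<le> h \<Longrightarrow> \<bar>g s - g t\<bar> \<le> w"
  shows "\<bar>integral {x0..grid x0 h n} g - trapezium h n (\<lambda>i. g (grid x0 h i))\<bar> \<le> real n * h * w"
  using assms(2,3)
proof (induction n)
  case 0
  then show ?case by (simp add: trapezium_def)
next
  case (Suc n)
  let ?p = "grid x0 h n" and ?q = "grid x0 h (Suc n)"
  have pq: "x0 \<le> ?p" "?p \<le> ?q" "?q = ?p + h"
    using assms(1) by (auto simp: grid_def algebra_simps)
  have int: "g integrable_on {x0..?q}"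
    using Suc.prems(1) by (rule integrable_continuous_real)
  have intpq: "g integrable_on {?p..?q}"
    using int by (rule integrable_on_subinterval) (use pq in auto)
  have IH: "\<bar>integral {x0..?p} g - trapezium h n (\<lambda>i. g (grid x0 h i))\<bar> \<le> real n * h * w"
    by (rule Suc.IH) (use pq Suc.prems in \<open>auto intro: continuous_on_subset\<close>)
  have split: "integral {x0..?q} g = integral {x0..?p} g + integral {?p..?q} g"
    using Henstock_Kurzweil_Integration.integral_combine[OF pq(1,2) int] by simp
  let ?c = "(g ?p + g ?q) / 2"
  have "\<bar>integral {?p..?q} (\<lambda>t. g t - ?c)\<bar> \<le> w * (?q - ?p)"
  proof -
    have b: "\<bar>g t - ?c\<bar> \<le> w" if "t \<in> {?p..?q}" for t
    proof -
      have "\<bar>g t - g ?p\<bar> \<le> w" "\<bar>g t - g ?q\<bar> \<le> w"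
        using that pq by (auto intro!: Suc.prems(2))
      then show ?thesis by (simp add: abs_le_iff field_simps)
    qed
    have "norm (integral {?p..?q} (\<lambda>t. g t - ?c)) \<le> w * (?q - ?p)"
      using pq b Suc.prems(1)
      by (intro integral_bound) (auto intro!: continuous_intros elim: continuous_on_subset)
    then show ?thesis by simp
  qed
  moreover have "integral {?p..?q} (\<lambda>t. g t - ?c) = integral {?p..?q} g - h * ?c"
    using intpq pq by (subst integral_diff) auto
  ultimately have "\<bar>integral {?p..?q} g - h / 2 * (g ?p + g ?q)\<bar> \<le> h * w"
    using pq by (simp add: field_simps)
  moreover have "trapezium h (Suc n) (\<lambda>i. g (grid x0 h i))
      = trapezium h n (\<lambda>i. g (grid x0 h i)) + h / 2 * (g ?p + g ?q)"
    by (simp add: trapezium_def algebra_simps)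
  ultimately show ?case
    unfolding split using IH by (simp add: algebra_simps)
qed

section \<open>Continuity of Volterra integrals\<close>

text \<open>The argument \<open>x\<close> occurs both in the integrand and in the upper limit. Rescaling
  \<open>{b..x}\<close> to the unit interval moves both occurrences into the integrand.\<close>
lemma continuous_on_Volterra_integral:
  fixes k :: "real \<Rightarrow> real \<Rightarrow> real"
  assumes "continuous_on ({b..c} \<times> {b..c}) (\<lambda>(x, t). k x t)"
  shows "continuous_on {b..c} (\<lambda>x. integral {b..x} (k x))"
proof -
  have rescale: "integral {b..x} (k x) = (x - b) * integral {0..1} (\<lambda>s. k x (b + s * (x - b)))"
    if x: "x \<in> {b..c}" for x
  proof (cases "x = b")
    case False
    then have bx: "b < x" using x by auto
    have "continuous_on {b..x} (k x)"
      using x by (intro continuous_on_compose2[OF assms, of "{b..x}" "\<lambda>t. (x, t)", simplified]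
        continuous_intros) auto
    then have "(k x has_integral integral {b..x} (k x)) (cbox b x)"
      by (simp add: integrable_continuous_real integrable_integral)
    from has_integral_affinity'[OF this, of "x - b" b]
    have "((\<lambda>s. k x ((x - b) * s + b)) has_integral integral {b..x} (k x) / (x - b)) {0..1}"
      using bx by (simp add: divide_inverse mult.commute)
    then have "integral {0..1} (\<lambda>s. k x (b + s * (x - b))) = integral {b..x} (k x) / (x - b)"
      by (simp add: integral_unique add.commute mult.commute)
    then show ?thesis
      using bx by (simp add: field_simps)
  qed simp
  have inside: "b + s * (x - b) \<in> {b..c}" if "x \<in> {b..c}" "s \<in> {0..1}" for x s
    using that mult_left_le_one_le[of "x - b" s] by auto
  have "continuous_on ({b..c} \<times> cbox 0 1) (\<lambda>(x, s). k x (b + s * (x - b)))"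
    using continuous_on_compose2[OF assms, of "{b..c} \<times> {0..1}" "\<lambda>p. (fst p, b + snd p * (fst p - b))"] inside
    by (force simp: case_prod_unfold intro: continuous_intros)
  then have "continuous_on {b..c} (\<lambda>x. integral (cbox 0 1) (\<lambda>s. k x (b + s * (x - b))))"
    by (rule integral_continuous_on_param)
  then have "continuous_on {b..c} (\<lambda>x. (x - b) * integral {0..1} (\<lambda>s. k x (b + s * (x - b))))"
    by (auto intro!: continuous_intros)
  then show ?thesis
    by (rule continuous_on_eq) (use rescale in auto)
qed

section \<open>The scheme as an iterated implicit trapezium rule\<close>

text \<open>The right-hand side of the equation at the grid point \<open>j\<close>, as it is seen by a method that
  knows the solution only through the grid values \<open>v\<close>.\<close>
definition discrete_slope ::
  "(real \<Rightarrow> real \<Rightarrow> real) \<Rightarrow> (real \<Rightarrow> real \<Rightarrow> real \<Rightarrow> real) \<Rightarrow> real \<Rightarrow> real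
    \<Rightarrow> (nat \<Rightarrow> real) \<Rightarrow> nat \<Rightarrow> real" where
  "discrete_slope f K x0 h v j =
     f (grid x0 h j) (v j) + trapezium h j (\<lambda>i. K (grid x0 h j) (grid x0 h i) (v i))"

text \<open>A fixed point in \<open>m\<close> would be a step of the implicit trapezium rule.\<close>
definition corrector ::
  "(real \<Rightarrow> real \<Rightarrow> real) \<Rightarrow> (real \<Rightarrow> real \<Rightarrow> real \<Rightarrow> real) \<Rightarrow> real \<Rightarrow> real
    \<Rightarrow> (nat \<Rightarrow> real) \<Rightarrow> nat \<Rightarrow> real \<Rightarrow> real" where
  "corrector f K x0 h v j m =
     v j + h / 2 * (discrete_slope f K x0 h v j + discrete_slope f K x0 h (v(Suc j := m)) (Suc j))"

text \<open>This holds for every \<open>m\<close>. With \<open>m\<close> one of the method's own values it turns the scheme into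
  iterates of \<open>corrector\<close>; with \<open>m\<close> the exact next value it measures how far \<open>M1\<close> is from the
  solution.\<close>
lemma M1_plus_implicit_terms:
  "M1 f K x0 h v j + h / 2 * f (grid x0 h (Suc j)) m
     + h\<^sup>2 / 4 * K (grid x0 h (Suc j)) (grid x0 h (Suc j)) m
   = corrector f K x0 h v j m"
proof -
  let ?g = "grid x0 h"
  have "trapezium h (Suc j) (\<lambda>i. K (?g (Suc j)) (?g i) ((v(Suc j := m)) i))
     = h / 2 * (K (?g (Suc j)) x0 (v 0) + K (?g (Suc j)) (?g (Suc j)) m)
       + h * (\<Sum>i=1..j. K (?g (Suc j)) (?g i) (v i))"
    by (simp add: trapezium_endpoint_form atLeastLessThanSuc_atLeastAtMost del: sum.op_ivl_Suc)
  note * = this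
  show ?thesis
    unfolding corrector_def discrete_slope_def M1_def Let_def *
    by (simp add: trapezium_endpoint_form[of h j] power2_eq_square field_simps)
qed

lemma M2_eq_corrector: "M2 f K x0 h v j = corrector f K x0 h v j (M1 f K x0 h v j)"
  using M1_plus_implicit_terms[of f K x0 h v j "M1 f K x0 h v j"] by (simp add: M2_def Let_def)

lemma generated_by_method_iff_corrector:
  "generated_by_method f K x0 y0 h N v \<longleftrightarrow>
     v 0 = y0 \<and> (\<forall>j<N. v (Suc j) = corrector f K x0 h v j (M2 f K x0 h v j))"
  by (simp add: generated_by_method_def Let_def M1_plus_implicit_terms[symmetric])

section \<open>Accumulation of errors\<close>

text \<open>A discrete Gronwall inequality with memory: the step hypothesis may use a common bound \<open>d\<close>
  for all previous errors, and the bounds \<open>\<tau> * (1 + q) ^ i\<close> increase with \<open>i\<close>, so the latest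
  of them is such a \<open>d\<close>. Requiring the step only for \<open>\<tau> \<le> d\<close> allows a local error of size
  \<open>q * \<tau>\<close> to be absorbed into the factor \<open>1 + q\<close>.\<close>
lemma geometric_error_growth:
  fixes e :: "nat \<Rightarrow> real"
  assumes "0 \<le> q" "0 \<le> \<tau>" and "e 0 \<le> \<tau>"
    and "\<And>j d. j < N \<Longrightarrow> \<tau> \<le> d \<Longrightarrow> (\<And>i. i \<le> j \<Longrightarrow> e i \<le> d) \<Longrightarrow> e (Suc j) \<le> (1 + q) * d"
  shows "j \<le> N \<Longrightarrow> e j \<le> \<tau> * exp (real j * q)"
proof -
  have pow_mono: "\<tau> * (1 + q) ^ i \<le> \<tau> * (1 + q) ^ j" if "i \<le> j" for i j
    using that assms(1,2) by (intro mult_left_mono power_increasing) auto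
  have pow: "j \<le> N \<Longrightarrow> \<forall>i\<le>j. e i \<le> \<tau> * (1 + q) ^ i" for j
  proof (induction j)
    case 0
    then show ?case using assms(3) by simp
  next
    case (Suc j)
    then have IH: "\<forall>i\<le>j. e i \<le> \<tau> * (1 + q) ^ i" by simp
    have "e (Suc j) \<le> (1 + q) * (\<tau> * (1 + q) ^ j)"
    proof (rule assms(4))
      show "j < N" using Suc.prems by simp
      show "\<tau> \<le> \<tau> * (1 + q) ^ j" using pow_mono[of 0 j] by simp
      show "e i \<le> \<tau> * (1 + q) ^ j" if "i \<le> j" for i
        using IH that pow_mono[of i j] by force
    qed
    with IH show ?case
      by (auto simp: le_Suc_eq algebra_simps)
  qed
  assume "j \<le> N"
  then have "e j \<le> \<tau> * (1 + q) ^ j" using pow by blast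
  also have "\<dots> \<le> \<tau> * exp q ^ j"
    using assms(1,2) by (intro mult_left_mono power_mono exp_ge_add_one_self) auto
  finally show ?thesis by (simp add: exp_of_nat_mult)
qed

section \<open>The exact solution\<close>
locale lipschitz_vide =
  fixes f :: "real \<Rightarrow> real \<Rightarrow> real"
    and K :: "real \<Rightarrow> real \<Rightarrow> real \<Rightarrow> real"
    and x0 y0 a L1 L2 :: real
    and y :: "real \<Rightarrow> real"
  assumes a_pos: "0 < a"
    and f_cont: "continuous_on ({x0..x0 + a} \<times> UNIV) (\<lambda>(x, u). f x u)"
    and K_cont: "continuous_on ({x0..x0 + a} \<times> {x0..x0 + a} \<times> UNIV) (\<lambda>(x, t, u). K x t u)"
    and f_lip: "\<And>x u v. x \<in> {x0..x0 + a} \<Longrightarrow> \<bar>f x u - f x v\<bar> \<le> L1 * \<bar>u - v\<bar>"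
    and K_lip: "\<And>x t u v. x \<in> {x0..x0 + a} \<Longrightarrow> t \<in> {x0..x0 + a} \<Longrightarrow>
                  \<bar>K x t u - K x t v\<bar> \<le> L2 * \<bar>u - v\<bar>"
    and solution: "vide_solution f K x0 y0 a y"
begin

text \<open>The derivative of the exact solution, by \<open>y_deriv\<close> below.\<close>
definition slope :: "real \<Rightarrow> real" where
  "slope x = f x (y x) + integral {x0..x} (\<lambda>t. K x t (y t))"

text \<open>The Lipschitz constant of \<open>discrete_slope\<close> in the grid values: the trapezium weights on a
  grid inside the interval sum to at most \<open>a\<close>.\<close>
definition L :: real where "L = L1 + a * L2"

abbreviation exact :: "real \<Rightarrow> nat \<Rightarrow> real" where
  "exact h i \<equiv> y (grid x0 h i)"

lemma y_deriv: "x \<in> {x0..x0 + a} \<Longrightarrow> (y has_real_derivative slope x) (at x within {x0..x0 + a})"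
  using solution by (auto simp: vide_solution_def slope_def)

lemma y_cont: "continuous_on {x0..x0 + a} y"
  using y_deriv by (rule DERIV_continuous_on)

lemma L1_nonneg: "0 \<le> L1"
  using f_lip[of x0 1 0] a_pos by auto

lemma L2_nonneg: "0 \<le> L2"
  using K_lip[of x0 x0 1 0] a_pos by auto

lemma L_nonneg: "0 \<le> L"
  using L1_nonneg L2_nonneg a_pos by (simp add: L_def)

lemma f_along_cont: "continuous_on {x0..x0 + a} (\<lambda>x. f x (y x))"
  by (rule continuous_on_compose2[OF f_cont, of "{x0..x0 + a}" "\<lambda>x. (x, y x)", simplified])
    (auto intro: continuous_on_Pair y_cont)

lemma K_along_cont: "continuous_on ({x0..x0 + a} \<times> {x0..x0 + a}) (\<lambda>(x, t). K x t (y t))"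
proof -
  have "continuous_on ({x0..x0 + a} \<times> {x0..x0 + a}) (\<lambda>p. y (snd p))"
    by (rule continuous_on_compose2[OF y_cont]) (auto intro!: continuous_intros)
  then show ?thesis
    unfolding case_prod_unfold
    by (intro continuous_on_compose2[OF K_cont, of "{x0..x0 + a} \<times> {x0..x0 + a}"
          "\<lambda>p. (fst p, snd p, y (snd p))", simplified]
      continuous_intros) auto
qed

lemma slope_cont: "continuous_on {x0..x0 + a} slope"
  unfolding slope_def[abs_def]
  using f_along_cont continuous_on_Volterra_integral[OF K_along_cont]
  by (rule continuous_on_add)

lemma grid_in: "0 < h \<Longrightarrow> grid x0 h N \<le> x0 + a \<Longrightarrow> i \<le> N \<Longrightarrow> grid x0 h i \<in> {x0..x0 + a}"
  using grid_mono[of h i N x0] grid_mono[of h 0 i x0] by simp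

lemma discrete_slope_lipschitz:
  assumes h: "0 < h" "grid x0 h j \<le> x0 + a"
    and d: "\<And>i. i \<le> j \<Longrightarrow> \<bar>v i - w i\<bar> \<le> d"
  shows "\<bar>discrete_slope f K x0 h v j - discrete_slope f K x0 h w j\<bar> \<le> L * d"
proof -
  let ?g = "grid x0 h"
  have d0: "0 \<le> d" using d[of 0] by simp
  have "\<bar>f (?g j) (v j) - f (?g j) (w j)\<bar> \<le> L1 * d"
    using f_lip[OF grid_in[OF h order_refl]] d[of j] L1_nonneg
    by (meson mult_left_mono order_refl order_trans)
  moreover have "\<bar>trapezium h j (\<lambda>i. K (?g j) (?g i) (v i)) - trapezium h j (\<lambda>i. K (?g j) (?g i) (w i))\<bar>
      \<le> real j * h * (L2 * d)"
  proof (rule trapezium_diff_le)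
    show "\<bar>K (?g j) (?g i) (v i) - K (?g j) (?g i) (w i)\<bar> \<le> L2 * d" if "i \<le> j" for i
      using K_lip[OF grid_in[OF h order_refl] grid_in[OF h that]] d[OF that] L2_nonneg
      by (meson mult_left_mono order_trans)
  qed (use h in auto)
  moreover have "real j * h * (L2 * d) \<le> a * (L2 * d)"
    using h d0 L2_nonneg by (intro mult_right_mono) (auto simp: grid_def)
  ultimately show ?thesis
    unfolding discrete_slope_def L_def by (simp add: algebra_simps)
qed

section \<open>Consistency\<close>

text \<open>Two errors are controlled by uniform continuity: moving from \<open>\<xi>\<close> to the grid point, and
  replacing the integral by the trapezium sum. The free point \<open>\<xi>\<close> is there for the mean value
  theorem, whose intermediate point is within \<open>h\<close> of both ends of its step.\<close>
lemma discrete_slope_consistent: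
  assumes "0 < \<epsilon>"
  obtains \<eta> where "0 < \<eta>"
    and "\<And>h j \<xi>. 0 < h \<Longrightarrow> h < \<eta> \<Longrightarrow> grid x0 h j \<le> x0 + a \<Longrightarrow> \<xi> \<in> {x0..x0 + a} \<Longrightarrow>
          \<bar>\<xi> - grid x0 h j\<bar> \<le> h \<Longrightarrow> \<bar>slope \<xi> - discrete_slope f K x0 h (exact h) j\<bar> \<le> \<epsilon>"
proof -
  let ?I = "{x0..x0 + a}"
  \<comment> \<open>The quadrature error is at most \<open>a * w\<close>; this choice makes it half of \<open>\<epsilon>\<close>.\<close>
  define w where "w = \<epsilon> / (2 * a)"
  have w: "0 < w" using assms a_pos by (simp add: w_def)
  have "uniformly_continuous_on ?I slope"
    by (rule compact_uniformly_continuous[OF slope_cont]) simp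
  then obtain \<eta>1 where \<eta>1: "0 < \<eta>1"
    "\<And>s t. s \<in> ?I \<Longrightarrow> t \<in> ?I \<Longrightarrow> \<bar>s - t\<bar> < \<eta>1 \<Longrightarrow> \<bar>slope s - slope t\<bar> < \<epsilon> / 2"
    using assms unfolding uniformly_continuous_on_def dist_real_def
    by (metis half_gt_zero)
  have "uniformly_continuous_on (?I \<times> ?I) (\<lambda>(x, t). K x t (y t))"
    by (rule compact_uniformly_continuous[OF K_along_cont]) (simp add: compact_Times)
  then obtain \<eta>2 where \<eta>2: "0 < \<eta>2"
    "\<forall>p\<in>?I \<times> ?I. \<forall>q\<in>?I \<times> ?I. dist q p < \<eta>2 \<longrightarrow>
       dist ((\<lambda>(x, t). K x t (y t)) q) ((\<lambda>(x, t). K x t (y t)) p) < w"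
    using w unfolding uniformly_continuous_on_def by blast
  have \<eta>2': "\<bar>K x s (y s) - K x t (y t)\<bar> \<le> w"
    if "x \<in> ?I" "s \<in> ?I" "t \<in> ?I" "\<bar>s - t\<bar> < \<eta>2" for x s t
    using bspec[OF bspec[OF \<eta>2(2), of "(x, t)"], of "(x, s)"] that by (simp add: dist_Pair_Pair dist_real_def)
  show ?thesis
  proof
    show "0 < min \<eta>1 \<eta>2" using \<eta>1(1) \<eta>2(1) by simp
    fix h j \<xi>
    assume h: "0 < h" "h < min \<eta>1 \<eta>2" and j: "grid x0 h j \<le> x0 + a"
      and \<xi>: "\<xi> \<in> ?I" "\<bar>\<xi> - grid x0 h j\<bar> \<le> h"
    let ?x = "grid x0 h j"
    have x: "?x \<in> ?I" using grid_in[OF h(1) j] by simp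
    have "\<bar>slope \<xi> - slope ?x\<bar> \<le> \<epsilon> / 2"
      using \<eta>1(2)[OF \<xi>(1) x] \<xi>(2) h(2) by simp
    moreover have "\<bar>slope ?x - discrete_slope f K x0 h (exact h) j\<bar> \<le> real j * h * w"
    proof -
      have c: "continuous_on {x0..?x} (\<lambda>t. K ?x t (y t))"
        using x by (intro continuous_on_compose2[OF K_along_cont, of "{x0..?x}" "\<lambda>t. (?x, t)", simplified]
          continuous_intros) auto
      have "\<bar>integral {x0..?x} (\<lambda>t. K ?x t (y t)) - trapezium h j (\<lambda>i. K ?x (grid x0 h i) (exact h i))\<bar>
          \<le> real j * h * w"
        by (rule trapezium_integral_error[OF _ c]) (use h x in \<open>auto intro!: \<eta>2'\<close>)
      then show ?thesis by (simp add: slope_def discrete_slope_def)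
    qed
    moreover have "real j * h * w \<le> a * w"
      using j w by (intro mult_right_mono) (auto simp: grid_def)
    moreover have "a * w = \<epsilon> / 2" using a_pos by (simp add: w_def)
    ultimately show "\<bar>slope \<xi> - discrete_slope f K x0 h (exact h) j\<bar> \<le> \<epsilon>" by linarith
  qed
qed

text \<open>The implicit trapezium rule, applied to exact values, has local error at most
  \<open>h * \<epsilon>\<close> in every step inside the interval.\<close>
definition consistent_at :: "real \<Rightarrow> real \<Rightarrow> bool" where
  "consistent_at h \<epsilon> \<longleftrightarrow> (\<forall>j. grid x0 h (Suc j) \<le> x0 + a \<longrightarrow>
     \<bar>corrector f K x0 h (exact h) j (exact h (Suc j)) - exact h (Suc j)\<bar> \<le> h * \<epsilon>)"

lemma corrector_consistent:
  assumes "0 < \<epsilon>"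
  obtains \<eta> where "0 < \<eta>" and "\<And>h. 0 < h \<Longrightarrow> h < \<eta> \<Longrightarrow> consistent_at h \<epsilon>"
proof -
  obtain \<eta> where \<eta>: "0 < \<eta>" "\<And>h j \<xi>. 0 < h \<Longrightarrow> h < \<eta> \<Longrightarrow> grid x0 h j \<le> x0 + a \<Longrightarrow> \<xi> \<in> {x0..x0 + a} \<Longrightarrow>
      \<bar>\<xi> - grid x0 h j\<bar> \<le> h \<Longrightarrow> \<bar>slope \<xi> - discrete_slope f K x0 h (exact h) j\<bar> \<le> \<epsilon>"
    using discrete_slope_consistent[OF assms] by metis
  have "consistent_at h \<epsilon>" if h: "0 < h" "h < \<eta>" for h
    unfolding consistent_at_def
  proof (intro allI impI)
    fix j assume j: "grid x0 h (Suc j) \<le> x0 + a"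
    let ?p = "grid x0 h j" and ?q = "grid x0 h (Suc j)" and ?s = "discrete_slope f K x0 h (exact h)"
    have p: "?p \<in> {x0..x0 + a}" and pq: "?q = ?p + h" and p': "?p \<le> x0 + a"
      using grid_in[OF h(1) j, of j] by (auto simp: grid_Suc)
    obtain \<xi> where \<xi>: "?p < \<xi>" "\<xi> < ?q" "y ?q - y ?p = (?q - ?p) * slope \<xi>"
    proof -
      have "\<exists>\<xi>\<in>{?p<..<?q}. y ?q - y ?p = slope \<xi> * (?q - ?p)"
      proof (rule mvt_simple[where f' = "\<lambda>x. (*) (slope x)"])
        show "(y has_derivative (*) (slope x)) (at x within {?p..?q})" if "?p \<le> x" "x \<le> ?q" for x
          using y_deriv[of x] that p pq j
          by (auto simp: has_field_derivative_def intro: has_derivative_subset)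
      qed (use pq h in simp)
      then show ?thesis using that by (auto simp: mult.commute)
    qed
    have "\<bar>slope \<xi> - ?s j\<bar> \<le> \<epsilon>" "\<bar>slope \<xi> - ?s (Suc j)\<bar> \<le> \<epsilon>"
      using \<xi> p pq j p' by (auto intro!: \<eta>(2)[OF h])
    then have "\<bar>(?s j + ?s (Suc j)) / 2 - slope \<xi>\<bar> \<le> \<epsilon>"
      by (auto simp: abs_if field_simps split: if_splits)
    then have "h * \<bar>(?s j + ?s (Suc j)) / 2 - slope \<xi>\<bar> \<le> h * \<epsilon>"
      using h by (intro mult_left_mono) auto
    moreover have "corrector f K x0 h (exact h) j (exact h (Suc j)) - exact h (Suc j)
        = h * ((?s j + ?s (Suc j)) / 2 - slope \<xi>)"
    proof -
      have "(exact h)(Suc j := exact h (Suc j)) = exact h" by auto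
      then show ?thesis using \<xi>(3) pq by (simp add: corrector_def algebra_simps)
    qed
    ultimately show "\<bar>corrector f K x0 h (exact h) j (exact h (Suc j)) - exact h (Suc j)\<bar> \<le> h * \<epsilon>"
      using h by (simp add: abs_mult)
  qed
  with \<eta>(1) show ?thesis using that by blast
qed

section \<open>Stability and the error of one step\<close>

text \<open>The error of the guess \<open>m\<close> enters only through slopes and is therefore damped by \<open>h * L\<close>; each
  sweep gains a power of \<open>h\<close> in this way.\<close>
lemma corrector_error:
  assumes h: "0 < h" "grid x0 h (Suc j) \<le> x0 + a" and cons: "consistent_at h \<epsilon>"
    and d: "\<And>i. i \<le> j \<Longrightarrow> \<bar>v i - exact h i\<bar> \<le> d"
    and m: "\<bar>m - exact h (Suc j)\<bar> \<le> \<mu>"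
  shows "\<bar>corrector f K x0 h v j m - exact h (Suc j)\<bar> \<le> d + h * L * (d + \<mu>) + h * \<epsilon>"
proof -
  let ?s = "discrete_slope f K x0 h"
  \<comment> \<open>\<open>?E\<close> is \<open>exact h\<close>, written in the form in which it occurs in \<open>corrector_def\<close>.\<close>
  let ?E = "(exact h)(Suc j := exact h (Suc j))"
  have average: "\<bar>(p + q) / 2\<bar> \<le> r" if "\<bar>p\<bar> \<le> r" "\<bar>q\<bar> \<le> r" for p q r :: real
    using that by (simp add: abs_le_iff)
  have nonneg: "0 \<le> d" "0 \<le> \<mu>" using d[of 0] m by auto
  have j: "grid x0 h j \<le> x0 + a" using h by (simp add: grid_Suc)
  have s1: "\<bar>?s v j - ?s (exact h) j\<bar> \<le> L * d"
    by (rule discrete_slope_lipschitz[OF h(1) j d])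
  have s2: "\<bar>?s (v(Suc j := m)) (Suc j) - ?s ?E (Suc j)\<bar> \<le> L * (d + \<mu>)"
  proof (rule discrete_slope_lipschitz[OF h])
    fix i assume "i \<le> Suc j"
    then show "\<bar>(v(Suc j := m)) i - ?E i\<bar> \<le> d + \<mu>"
      using d[of i] m nonneg by (cases "i = Suc j") auto
  qed
  have "L * d \<le> L * (d + \<mu>)" using L_nonneg nonneg by (intro mult_left_mono) auto
  then have "\<bar>(?s v j - ?s (exact h) j + (?s (v(Suc j := m)) (Suc j) - ?s ?E (Suc j))) / 2\<bar> \<le> L * (d + \<mu>)"
    using average[OF order_trans[OF s1] s2] by blast
  then have "h * \<bar>(?s v j - ?s (exact h) j + (?s (v(Suc j := m)) (Suc j) - ?s ?E (Suc j))) / 2\<bar>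
      \<le> h * (L * (d + \<mu>))"
    using h by (intro mult_left_mono) auto
  then have "\<bar>h * ((?s v j - ?s (exact h) j + (?s (v(Suc j := m)) (Suc j) - ?s ?E (Suc j))) / 2)\<bar>
      \<le> h * L * (d + \<mu>)"
    using h by (simp add: abs_mult)
  moreover have "corrector f K x0 h v j m - corrector f K x0 h (exact h) j (exact h (Suc j))
     = (v j - exact h j) + h * ((?s v j - ?s (exact h) j + (?s (v(Suc j := m)) (Suc j) - ?s ?E (Suc j))) / 2)"
    by (simp add: corrector_def field_simps)
  moreover have "\<bar>corrector f K x0 h (exact h) j (exact h (Suc j)) - exact h (Suc j)\<bar> \<le> h * \<epsilon>"
    using cons h by (simp add: consistent_at_def)
  ultimately show ?thesis using d[of j] by linarith
qed

text \<open>These are the terms that \<open>M1\<close> lacks when the exact next value is the guess. One of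
  the two factors \<open>h\<close> of the second term is absorbed into \<open>B\<close> by \<open>h \<le> a\<close>.\<close>
lemma implicit_terms_bounded:
  obtains B where "0 \<le> B" and "\<And>h x. 0 < h \<Longrightarrow> h \<le> a \<Longrightarrow> x \<in> {x0..x0 + a} \<Longrightarrow>
    \<bar>h / 2 * f x (y x) + h\<^sup>2 / 4 * K x x (y x)\<bar> \<le> h * B"
proof -
  have "continuous_on {x0..x0 + a} (\<lambda>x. case (x, x) of (x, t) \<Rightarrow> K x t (y t))"
    by (rule continuous_on_compose2[OF K_along_cont continuous_on_Pair]) auto
  then have diag: "continuous_on {x0..x0 + a} (\<lambda>x. K x x (y x))"
    by simp
  have bounded_on_I: "\<exists>B. \<forall>x\<in>{x0..x0 + a}. \<bar>g x\<bar> \<le> B"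
    if "continuous_on {x0..x0 + a} g" for g :: "real \<Rightarrow> real"
    using compact_imp_bounded[OF compact_continuous_image[OF that compact_Icc]]
    by (simp add: bounded_iff)
  obtain B1 B2 where B1: "\<And>x. x \<in> {x0..x0 + a} \<Longrightarrow> \<bar>f x (y x)\<bar> \<le> B1"
    and B2: "\<And>x. x \<in> {x0..x0 + a} \<Longrightarrow> \<bar>K x x (y x)\<bar> \<le> B2"
    using bounded_on_I[OF f_along_cont] bounded_on_I[OF diag] by blast
  have pos: "0 \<le> B1" "0 \<le> B2" using B1[of x0] B2[of x0] a_pos by auto
  show ?thesis
  proof
    show "0 \<le> B1 + a * B2" using pos a_pos by simp
    fix h x assume h: "0 < h" "h \<le> a" and x: "x \<in> {x0..x0 + a}"
    have "\<bar>h / 4 * K x x (y x)\<bar> \<le> a * B2"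
      unfolding abs_mult using h B2[OF x] by (intro mult_mono) auto
    then have "\<bar>f x (y x) / 2 + h / 4 * K x x (y x)\<bar> \<le> B1 + a * B2"
      using B1[OF x] pos by linarith
    then have "h * \<bar>f x (y x) / 2 + h / 4 * K x x (y x)\<bar> \<le> h * (B1 + a * B2)"
      using h by (intro mult_left_mono) auto
    moreover have "h / 2 * f x (y x) + h\<^sup>2 / 4 * K x x (y x) = h * (f x (y x) / 2 + h / 4 * K x x (y x))"
      by (simp add: power2_eq_square algebra_simps)
    ultimately show "\<bar>h / 2 * f x (y x) + h\<^sup>2 / 4 * K x x (y x)\<bar> \<le> h * (B1 + a * B2)"
      using h by (simp add: abs_mult)
  qed
qed

text \<open>Follows the error through \<open>M1\<close>, \<open>M2\<close> and the new value. In the bound, the terms with \<open>d\<close>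
  give the factor \<open>1 + O(h)\<close> by which accumulated errors grow; the defect
  \<open>h * B\<close> of \<open>M1\<close> enters with another factor \<open>h\<close>. One such gain is enough, so the sweep from \<open>M1\<close>
  to \<open>M2\<close> is estimated with \<open>h * L \<le> a * L\<close> only.\<close>
lemma one_step_error:
  assumes h: "0 < h" "h \<le> a" "grid x0 h (Suc j) \<le> x0 + a" and cons: "consistent_at h \<epsilon>" and \<epsilon>: "0 \<le> \<epsilon>"
    and B: "0 \<le> B" "\<bar>h / 2 * f (grid x0 h (Suc j)) (exact h (Suc j))
           + h\<^sup>2 / 4 * K (grid x0 h (Suc j)) (grid x0 h (Suc j)) (exact h (Suc j))\<bar> \<le> h * B"
    and d: "\<And>i. i \<le> j \<Longrightarrow> \<bar>v i - exact h i\<bar> \<le> d"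
  shows "\<bar>corrector f K x0 h v j (M2 f K x0 h v j) - exact h (Suc j)\<bar>
    \<le> d + h * L * (1 + (1 + a * L)\<^sup>2) * d + h * (\<epsilon> + h * (L * (1 + a * L) * (\<epsilon> + B)))"
proof -
  define c where "c = a * L"
  define e1 where "e1 = \<bar>M1 f K x0 h v j - exact h (Suc j)\<bar>"
  define e2 where "e2 = \<bar>M2 f K x0 h v j - exact h (Suc j)\<bar>"
  have d0: "0 \<le> d" using d[of 0] by simp
  have c0: "0 \<le> c" and hL: "0 \<le> h * L" "h * L \<le> c"
    using h a_pos L_nonneg by (auto simp: c_def mult_right_mono)
  have e1: "e1 \<le> (1 + c) * d + h * (\<epsilon> + B)"
  proof -
    have "\<bar>corrector f K x0 h v j (exact h (Suc j)) - exact h (Suc j)\<bar> \<le> d + h * L * (d + 0) + h * \<epsilon>"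
      by (rule corrector_error[OF h(1,3) cons d]) auto
    moreover have "h * L * d \<le> c * d" using hL d0 by (intro mult_right_mono)
    ultimately show ?thesis
      using B(2) M1_plus_implicit_terms[of f K x0 h v j "exact h (Suc j)"]
      unfolding e1_def by (simp add: algebra_simps)
  qed
  have e2: "e2 \<le> (1 + c)\<^sup>2 * d + h * ((1 + c) * (\<epsilon> + B))"
  proof -
    have "e2 \<le> d + h * L * (d + e1) + h * \<epsilon>"
      unfolding e2_def M2_eq_corrector by (rule corrector_error[OF h(1,3) cons d]) (auto simp: e1_def)
    also have "h * L * (d + e1) \<le> c * (d + ((1 + c) * d + h * (\<epsilon> + B)))"
      using hL c0 d0 e1 by (intro mult_mono) (auto simp: e1_def)
    finally have "e2 \<le> d + c * (d + ((1 + c) * d + h * (\<epsilon> + B))) + h * \<epsilon>" by simp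
    also have "\<dots> \<le> (1 + c)\<^sup>2 * d + h * ((1 + c) * (\<epsilon> + B))"
      using h B(1) by (simp add: power2_eq_square algebra_simps)
    finally show ?thesis .
  qed
  have "\<bar>corrector f K x0 h v j (M2 f K x0 h v j) - exact h (Suc j)\<bar> \<le> d + h * L * (d + e2) + h * \<epsilon>"
    by (rule corrector_error[OF h(1,3) cons d]) (auto simp: e2_def)
  also have "h * L * (d + e2) \<le> h * L * (d + ((1 + c)\<^sup>2 * d + h * ((1 + c) * (\<epsilon> + B))))"
    using hL e2 by (intro mult_left_mono) auto
  finally show ?thesis
    unfolding c_def[symmetric] by (simp add: algebra_simps)
qed

section \<open>Convergence\<close>
theorem convergent:
  assumes gen: "\<And>h N. 0 < h \<Longrightarrow> grid x0 h N \<le> x0 + a \<Longrightarrow> generated_by_method f K x0 y0 h N (Y h)"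
  shows "method_convergent x0 a y Y"
  unfolding method_convergent_def
proof (intro allI impI)
  fix e :: real assume e: "0 < e"
  obtain B where B: "0 \<le> B" "\<And>h x. 0 < h \<Longrightarrow> h \<le> a \<Longrightarrow> x \<in> {x0..x0 + a} \<Longrightarrow>
    \<bar>h / 2 * f x (y x) + h\<^sup>2 / 4 * K x x (y x)\<bar> \<le> h * B"
    using implicit_terms_bounded by metis
  \<comment> \<open>The summand \<open>1\<close> in \<open>C\<close> pays for the local error, which is at most \<open>h * (\<epsilon> + h * P)\<close> and
    hence at most \<open>h * (2 * \<epsilon>)\<close> for \<open>h < H\<close>. Errors thus start from the level \<open>2 * \<epsilon>\<close> and grow by at
    most \<open>exp (C * a)\<close>; the denominator \<open>3\<close> in \<open>\<epsilon>\<close> keeps the result strictly below \<open>e\<close>.\<close>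
  define C where "C = L * (1 + (1 + a * L)\<^sup>2) + 1"
  define \<epsilon> where "\<epsilon> = e / (3 * exp (C * a))"
  define P where "P = L * (1 + a * L) * (\<epsilon> + B)"
  have C: "0 \<le> C" unfolding C_def using L_nonneg by simp
  have \<epsilon>: "0 < \<epsilon>" using e by (simp add: \<epsilon>_def)
  have P: "0 \<le> P" using L_nonneg a_pos \<epsilon> B(1) by (simp add: P_def)
  obtain \<eta> where \<eta>: "0 < \<eta>" "\<And>h. 0 < h \<Longrightarrow> h < \<eta> \<Longrightarrow> consistent_at h \<epsilon>"
    using corrector_consistent[OF \<epsilon>] by metis
  define H where "H = min (min \<eta> a) (\<epsilon> / (P + 1))"
  have H: "0 < H" using \<eta> a_pos \<epsilon> P by (simp add: H_def)
  have bound: "\<bar>exact h j - Y h j\<bar> < e"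
    if h: "0 < h" "h < H" and N: "grid x0 h N \<le> x0 + a" and j: "j \<le> N" for h N j
  proof -
    have h': "h < \<eta>" "h \<le> a" and "h < \<epsilon> / (P + 1)" using h by (auto simp: H_def)
    then have "h * (P + 1) < \<epsilon>" using P by (simp add: field_simps)
    then have hP: "h * P \<le> \<epsilon>" using h by (simp add: algebra_simps)
    have Y: "Y h 0 = y0" "\<And>j. j < N \<Longrightarrow> Y h (Suc j) = corrector f K x0 h (Y h) j (M2 f K x0 h (Y h) j)"
      using gen[OF h(1) N] by (auto simp: generated_by_method_iff_corrector)
    have "\<bar>Y h j - exact h j\<bar> \<le> 2 * \<epsilon> * exp (real j * (h * C))"
    proof (rule geometric_error_growth[of _ _ "\<lambda>j. \<bar>Y h j - exact h j\<bar>"])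
      show "\<bar>Y h 0 - exact h 0\<bar> \<le> 2 * \<epsilon>"
        using Y(1) solution \<epsilon> by (simp add: vide_solution_def)
      fix j d assume j: "j < N" and d: "2 * \<epsilon> \<le> d" "\<And>i. i \<le> j \<Longrightarrow> \<bar>Y h i - exact h i\<bar> \<le> d"
      have g: "grid x0 h (Suc j) \<in> {x0..x0 + a}" using grid_in[OF h(1) N] j by simp
      have "\<bar>Y h (Suc j) - exact h (Suc j)\<bar>
        \<le> d + h * L * (1 + (1 + a * L)\<^sup>2) * d + h * (\<epsilon> + h * P)"
        unfolding Y(2)[OF j] P_def
        by (rule one_step_error) (use h h' g \<epsilon> \<eta>(2) B d(2) in auto)
      also have "h * (\<epsilon> + h * P) \<le> h * d"
        using h hP d(1) by (intro mult_left_mono) auto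
      finally show "\<bar>Y h (Suc j) - exact h (Suc j)\<bar> \<le> (1 + h * C) * d"
        by (simp add: C_def algebra_simps)
    qed (use h C \<epsilon> j in auto)
    also have "\<dots> \<le> 2 * \<epsilon> * exp (C * a)"
    proof -
      have "real j * h \<le> a" using grid_in[OF h(1) N j] by (simp add: grid_def)
      then have "real j * (h * C) \<le> C * a" using C by (metis mult.assoc mult.commute mult_right_mono)
      then show ?thesis using \<epsilon> by simp
    qed
    also have "\<dots> < e" using e by (simp add: \<epsilon>_def)
    finally show ?thesis by (simp add: abs_minus_commute)
  qed
  show "\<forall>\<^sub>F h in at_right 0. \<forall>N. grid x0 h N \<le> x0 + a \<longrightarrow> (\<forall>j\<in>{1..N}. \<bar>exact h j - Y h j\<bar> < e)"
    unfolding eventually_at_right_field using H bound by (intro exI[of _ H]) auto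
qed

end

theorem corollary1:
  fixes f :: "real \<Rightarrow> real \<Rightarrow> real"
    and K :: "real \<Rightarrow> real \<Rightarrow> real \<Rightarrow> real"
    and x0 y0 a L1 L2 :: real
    and y :: "real \<Rightarrow> real"
    and Y :: "real \<Rightarrow> nat \<Rightarrow> real"
  assumes "0 < a"
    and "continuous_on ({x0 - a..x0 + a} \<times> UNIV) (\<lambda>(x, u). f x u)"
    and "continuous_on ({x0 - a..x0 + a} \<times> {x0 - a..x0 + a} \<times> UNIV) (\<lambda>(x, t, u). K x t u)"
    and "\<And>x u v. \<bar>x - x0\<bar> \<le> a \<Longrightarrow> \<bar>f x u - f x v\<bar> \<le> L1 * \<bar>u - v\<bar>"
    and "\<And>x t u v. \<bar>x - x0\<bar> \<le> a \<Longrightarrow> \<bar>t - x0\<bar> \<le> a \<Longrightarrow> \<bar>K x t u - K x t v\<bar> \<le> L2 * \<bar>u - v\<bar>"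
    and "vide_solution f K x0 y0 a y"
    and "\<And>h N. 0 < h \<Longrightarrow> grid x0 h N \<le> x0 + a \<Longrightarrow> generated_by_method f K x0 y0 h N (Y h)"
  shows "method_convergent x0 a y Y"
proof -
  interpret lipschitz_vide f K x0 y0 a L1 L2 y
  proof
    show "continuous_on ({x0..x0 + a} \<times> UNIV) (\<lambda>(x, u). f x u)"
      by (rule continuous_on_subset[OF assms(2)]) (use assms(1) in auto)
    show "continuous_on ({x0..x0 + a} \<times> {x0..x0 + a} \<times> UNIV) (\<lambda>(x, t, u). K x t u)"
      by (rule continuous_on_subset[OF assms(3)]) (use assms(1) in auto)
  qed (use assms in auto)
  show ?thesis using assms(7) by (rule convergent)
qed

end
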